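(* Let $\Pi$ be a probability measure on $\mathbb{R}^d$ with density $\pi\propto\exp(-U)$, $U\in C^2(\mathbb{R}^d)$. Suppose there exist $L\in GL_d(\mathbb{R})$ and $\epsilon>0$ such that $\|\nabla^2U(x)-LL^T\|\le\sigma_d^2\epsilon$ for all $x\in\mathbb{R}^d$, where $\sigma_d^2$ is the least eigenvalue of $LL^T$. Then \[ \|\nabla^2U(x)-\mathcal{I}\|\le 2\sigma_d^2\epsilon\qquad\text{for all }x\in\mathbb{R}^d . \]
   Context: $\mathcal{I}:=\mathbb{E}_{\Pi}[\nabla U(X)\nabla U(X)^T]$ is the Fisher matrix, which by integration by parts also equals $\mathbb{E}_\Pi[\nabla^2U(X)]$. $\|\cdot\|$ is the operator 2-norm. *)

theory Defs
  imports "HOL-Probability.Probability"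
begin

definition gradient :: "(real ^ 'n \<Rightarrow> real) \<Rightarrow> real ^ 'n \<Rightarrow> real ^ 'n" where
  "gradient U x = (\<chi> i. frechet_derivative U (at x) (axis i 1))"

definition hessian :: "(real ^ 'n \<Rightarrow> real) \<Rightarrow> real ^ 'n \<Rightarrow> real ^ 'n ^ 'n" where
  "hessian U x = jacobian (gradient U) (at x)"

text \<open>Frechet derivatives have arbitrary values where they do not exist, hence the explicit
  differentiability conditions.\<close>

definition C2 :: "(real ^ 'n \<Rightarrow> real) \<Rightarrow> bool" where
  "C2 U \<longleftrightarrow> (\<forall>x. U differentiable (at x)) \<and> (\<forall>x. gradient U differentiable (at x)) \<and>
     continuous_on UNIV (hessian U)"

definition op_norm :: "real ^ 'n ^ 'm \<Rightarrow> real" where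
  "op_norm A = onorm (\<lambda>v. A *v v)"

definition eigenvalue :: "real ^ 'n ^ 'n \<Rightarrow> real \<Rightarrow> bool" where
  "eigenvalue A k \<longleftrightarrow> (\<exists>v. v \<noteq> 0 \<and> A *v v = k *\<^sub>R v)"

text \<open>The matrix should be symmetric: then there is a smallest real eigenvalue.\<close>

definition least_eigenvalue :: "real ^ 'n ^ 'n \<Rightarrow> real" where
  "least_eigenvalue A = (LEAST k. eigenvalue A k)"

definition outer_product :: "real ^ 'm \<Rightarrow> real ^ 'n \<Rightarrow> real ^ 'n ^ 'm" where
  "outer_product v w = (\<chi> i j. v $ i * w $ j)"

definition fisher_matrix :: "(real ^ 'n) measure \<Rightarrow> (real ^ 'n \<Rightarrow> real) \<Rightarrow> real ^ 'n ^ 'n" where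
  "fisher_matrix P U = (\<integral>x. outer_product (gradient U x) (gradient U x) \<partial>P)"

end

theory Submission
  imports Defs "HOL-Real_Asymp.Real_Asymp"
begin

text \<open>The bound on the Hessian of \<open>U\<close> traps the second derivative of \<open>U\<close> in each direction \<open>v\<close>
  between two constants \<open>a\<close> and \<open>b\<close>. With \<open>t\<close> for the derivative of \<open>U\<close> along \<open>v\<close>, Taylor expansion
  and translation invariance of Lebesgue measure give
  \<open>exp (a * h\<^sup>2 / 2) \<le> E (cosh (h * t)) \<le> exp (b * h\<^sup>2 / 2)\<close> for all \<open>h\<close>. Letting \<open>h\<close> tend to 0,
  \<open>t\<^sup>2\<close> is integrable and \<open>a \<le> E (t\<^sup>2) \<le> b\<close>, so that the quadratic form of the Fisher matrix obeys the
  same bounds as that of the Hessian; no integration by parts is needed.\<close>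

section \<open>One-variable estimates and translation of Lebesgue integrals\<close>

text \<open>Compare the power series term by term: every surviving term has even degree at least 2,
  so its factor \<open>h ^ n\<close> is at most \<open>h\<^sup>2\<close>. This makes the quotients
  \<open>(cosh (h * t) - 1) / h\<^sup>2\<close> bounded uniformly in small nonzero \<open>h\<close>,
  as dominated convergence requires.\<close>

lemma cosh_scale_le:
  fixes h t :: real
  assumes "\<bar>h\<bar> \<le> 1"
  shows "cosh (h * t) - 1 \<le> h\<^sup>2 * (cosh t - 1)"
proof -
  have sums: "(\<lambda>n. if even n \<and> n \<noteq> 0 then x ^ n /\<^sub>R fact n else 0) sums (cosh x - 1)" for x :: real
  proof -
    have "(\<lambda>n. (if even n then x ^ n /\<^sub>R fact n else 0) - (if n = 0 then 1 else 0)) sums (cosh x - 1)"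
      by (intro sums_diff cosh_converges sums_single)
    then show ?thesis
      by (rule sums_cong[THEN iffD1, rotated]) auto
  qed
  show ?thesis
  proof (rule sums_le[OF _ sums sums_mult[OF sums]])
    fix n
    have "(h * t) ^ n / fact n \<le> h\<^sup>2 * (t ^ n / fact n)" if n: "even n" "n \<noteq> 0"
    proof -
      have "2 \<le> n"
        using n by (auto elim!: evenE)
      then have "h ^ n \<le> h\<^sup>2"
        using power_decreasing[of 2 n "\<bar>h\<bar>"] assms n by (simp add: power_even_abs)
      moreover have "t ^ n / fact n \<ge> 0"
        using n by (simp add: zero_le_even_power)
      ultimately show ?thesis
        by (metis mult_right_mono power_mult_distrib times_divide_eq_right)
    qed
    then show "(if even n \<and> n \<noteq> 0 then (h * t) ^ n /\<^sub>R fact n else 0)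
        \<le> h\<^sup>2 * (if even n \<and> n \<noteq> 0 then t ^ n /\<^sub>R fact n else 0)"
      by (auto simp: field_simps)
  qed
qed

lemma Taylor_second_order:
  fixes g :: "real \<Rightarrow> real"
  assumes "\<And>s. (g has_real_derivative g' s) (at s)"
    and "\<And>s. (g' has_real_derivative g'' s) (at s)"
  obtains s where "g h = g 0 + h * g' 0 + g'' s * h\<^sup>2 / 2"
proof -
  \<comment> \<open>\<open>Maclaurin_bi_le\<close> wants a whole sequence of derivatives and treats
    both signs of \<open>h\<close>. At order 2 only the indices 0, 1 and 2 matter, so the later
    values are arbitrary.\<close>
  define diff where "diff = (\<lambda>n::nat. if n = 0 then g else if n = 1 then g' else g'')"
  have "\<forall>m t. m < 2 \<and> \<bar>t\<bar> \<le> \<bar>h\<bar> \<longrightarrow> (diff m has_real_derivative diff (Suc m) t) (at t)"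
    using assms by (auto simp: diff_def less_2_cases_iff)
  from Maclaurin_bi_le[of diff g 2 h, OF _ this]
  show thesis
    using that by (auto simp: diff_def numeral_2_eq_2 algebra_simps)
qed

lemma
  fixes f :: "'a::euclidean_space \<Rightarrow> real"
  assumes "integrable lborel f"
  shows integrable_lborel_shift: "integrable lborel (\<lambda>x. f (x + y))"
    and integral_lborel_shift: "(\<integral>x. f (x + y) \<partial>lborel) = (\<integral>x. f x \<partial>lborel)"
proof -
  have distr: "lborel = distr lborel borel ((+) y)"
    by (rule lborel_distr_plus[symmetric])
  have f: "f \<in> borel_measurable borel"
    using assms by simp
  have "integrable (distr lborel borel ((+) y)) f"
    using assms distr by simp
  then show "integrable lborel (\<lambda>x. f (x + y))"
    using f by (subst (asm) integrable_distr_eq) (auto simp: add.commute)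
  show "(\<integral>x. f (x + y) \<partial>lborel) = (\<integral>x. f x \<partial>lborel)"
    using f by (subst (2) distr, subst integral_distr) (auto simp: add.commute)
qed

text \<open>This limit and the next one turn the bounds on \<open>E (cosh (h * t))\<close> into
  bounds on \<open>E (t\<^sup>2)\<close>: subtract 1, multiply by \<open>2 / h\<^sup>2\<close>, and
  let \<open>h\<close> decrease to 0.\<close>

lemma tendsto_cosh_quotient:
  fixes t :: real
  shows "((\<lambda>h. 2 * (cosh (h * t) - 1) / h\<^sup>2) \<longlongrightarrow> t\<^sup>2) (at_right 0)"
  unfolding cosh_field_def power2_eq_square[of t] by real_asymp

lemma tendsto_exp_quotient:
  fixes b :: real
  shows "((\<lambda>h. 2 * (exp (b * h\<^sup>2 / 2) - 1) / h\<^sup>2) \<longlongrightarrow> b) (at_right 0)"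
  by real_asymp

section \<open>Taylor bounds along lines and moments of the directional derivative\<close>

lemma has_derivative_gradient:
  assumes "C2 U"
  shows "(U has_derivative (\<lambda>v. gradient U x \<bullet> v)) (at x)"
proof -
  have D: "(U has_derivative frechet_derivative U (at x)) (at x)"
    using assms by (simp add: C2_def frechet_derivative_works)
  interpret bounded_linear "frechet_derivative U (at x)"
    using D by (rule has_derivative_bounded_linear)
  have "frechet_derivative U (at x) v = gradient U x \<bullet> v" for v
  proof -
    have "frechet_derivative U (at x) v = frechet_derivative U (at x) (\<Sum>i\<in>UNIV. v $ i *\<^sub>R axis i 1)"
      by (simp add: basis_expansion flip: scalar_mult_eq_scaleR)
    also have "\<dots> = gradient U x \<bullet> v"
      by (simp add: sum scaleR gradient_def inner_vec_def mult.commute)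
    finally show ?thesis .
  qed
  then have "frechet_derivative U (at x) = (\<lambda>v. gradient U x \<bullet> v)"
    by (rule ext)
  with D show ?thesis
    by simp
qed

text \<open>Restricted to the line through \<open>x\<close> in direction \<open>v\<close>,
  \<open>U\<close> has the Hessian's quadratic form at \<open>v\<close> as second derivative, so the
  Lagrange remainder lies between the two quadratic terms.\<close>

lemma C2_Taylor_bounds:
  assumes "C2 U"
    and q: "\<And>x. a \<le> v \<bullet> (hessian U x *v v)" "\<And>x. v \<bullet> (hessian U x *v v) \<le> b"
  shows "U x + h * (gradient U x \<bullet> v) + a * h\<^sup>2 / 2 \<le> U (x + h *\<^sub>R v)"
    and "U (x + h *\<^sub>R v) \<le> U x + h * (gradient U x \<bullet> v) + b * h\<^sup>2 / 2"
proof -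
  have line: "((\<lambda>s. x + s *\<^sub>R v) has_derivative (\<lambda>r. r *\<^sub>R v)) (at s)" for s :: real
    by (auto intro!: derivative_eq_intros)
  have "((\<lambda>s. U (x + s *\<^sub>R v)) has_real_derivative gradient U (x + s *\<^sub>R v) \<bullet> v) (at s)" for s
    using has_derivative_compose[OF line has_derivative_gradient[OF assms(1)]]
    by (simp add: has_field_derivative_def mult.commute[of _ "_ \<bullet> _"])
  moreover have "((\<lambda>s. gradient U (x + s *\<^sub>R v) \<bullet> v) has_real_derivative
      v \<bullet> (hessian U (x + s *\<^sub>R v) *v v)) (at s)" for s
  proof -
    have "(gradient U has_derivative (\<lambda>w. hessian U y *v w)) (at y)" for y
      using assms(1) by (simp add: C2_def hessian_def jacobian_works)
    from has_derivative_inner_left[OF has_derivative_compose[OF line this]]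
    show ?thesis
      by (simp add: has_field_derivative_def matrix_vector_mult_scaleR inner_commute[of v]
          mult.commute[of _ "_ \<bullet> _"])
  qed
  ultimately obtain s where s: "U (x + h *\<^sub>R v) = U x + h * (gradient U x \<bullet> v)
      + (v \<bullet> (hessian U (x + s *\<^sub>R v) *v v)) * h\<^sup>2 / 2"
    by (rule Taylor_second_order[where h = h]) auto
  show "U x + h * (gradient U x \<bullet> v) + a * h\<^sup>2 / 2 \<le> U (x + h *\<^sub>R v)"
    "U (x + h *\<^sub>R v) \<le> U x + h * (gradient U x \<bullet> v) + b * h\<^sup>2 / 2"
    unfolding s using q[of "x + s *\<^sub>R v"] by (simp_all add: mult_right_mono)
qed

text \<open>By translation invariance, the integral of \<open>p (x + h *\<^sub>R v) + p (x - h *\<^sub>R v)\<close> is 2, whereas Taylor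
  expansion compares this sum with \<open>2 * cosh (h * t x) * p x\<close>.\<close>

lemma
  fixes p U t :: "'a::euclidean_space \<Rightarrow> real"
  assumes "c > 0" and p: "\<And>x. p x = c * exp (- U x)"
    and int: "integrable lborel p" and int1: "(\<integral>x. p x \<partial>lborel) = 1"
    and t [measurable]: "t \<in> borel_measurable borel"
    and lower: "\<And>x h. U x + h * t x + a * h\<^sup>2 / 2 \<le> U (x + h *\<^sub>R v)"
    and upper: "\<And>x h. U (x + h *\<^sub>R v) \<le> U x + h * t x + b * h\<^sup>2 / 2"
  shows integrable_cosh_derivative: "integrable lborel (\<lambda>x. cosh (h * t x) * p x)"
    and integral_cosh_derivative_ge: "exp (a * h\<^sup>2 / 2) \<le> (\<integral>x. cosh (h * t x) * p x \<partial>lborel)"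
    and integral_cosh_derivative_le: "(\<integral>x. cosh (h * t x) * p x \<partial>lborel) \<le> exp (b * h\<^sup>2 / 2)"
proof -
  let ?S = "\<lambda>x. (p (x + h *\<^sub>R v) + p (x + (- h) *\<^sub>R v)) / 2"
  have p_nonneg: "p x \<ge> 0" for x
    using \<open>c > 0\<close> by (simp add: p)
  have [measurable]: "p \<in> borel_measurable borel"
    using int by simp
  have S: "integrable lborel ?S"
    by (intro integrable_divide_zero Bochner_Integration.integrable_add integrable_lborel_shift int)
  \<comment> \<open>Keeping \<open>(- h) *\<^sub>R v\<close> unsimplified leaves both arguments in
    the form \<open>x + y\<close> that the shift lemmas match.\<close>
  have S1: "(\<integral>x. ?S x \<partial>lborel) = 1"
    by (simp add: integrable_lborel_shift integral_lborel_shift int int1 del: scaleR_minus_left)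
  \<comment> \<open>Since \<open>p\<close> decreases as \<open>U\<close> grows, the lower Taylor
    bound bounds \<open>p\<close> from above, and the upper one from below.\<close>
  have step_le: "p (x + k *\<^sub>R v) \<le> p x * exp (- (k * t x)) * exp (- (a * k\<^sup>2 / 2))" for x k
    using lower[of x k] \<open>c > 0\<close> by (simp add: p mult.assoc flip: exp_add)
  have step_ge: "p x * exp (- (k * t x)) * exp (- (b * k\<^sup>2 / 2)) \<le> p (x + k *\<^sub>R v)" for x k
    using upper[of x k] \<open>c > 0\<close> by (simp add: p mult.assoc flip: exp_add)
  \<comment> \<open>Averaging over \<open>h\<close> and \<open>- h\<close> combines the linear
    exponentials into \<open>cosh\<close>, while the quadratic factor is even in \<open>h\<close>
    and comes out.\<close>
  have S_le: "?S x \<le> exp (- (a * h\<^sup>2 / 2)) * (cosh (h * t x) * p x)" for x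
    using step_le[of x h] step_le[of x "- h"] by (simp add: cosh_field_def field_simps)
  have S_ge: "exp (- (b * h\<^sup>2 / 2)) * (cosh (h * t x) * p x) \<le> ?S x" for x
    using step_ge[of x h] step_ge[of x "- h"] by (simp add: cosh_field_def field_simps)
  \<comment> \<open>Integrability comes from the upper Taylor bound: the integrand is at most a
    constant times \<open>?S\<close>.\<close>
  have "cosh (h * t x) * p x \<le> exp (b * h\<^sup>2 / 2) * ?S x" for x
    using S_ge[of x] by (simp add: exp_minus field_simps)
  then show I: "integrable lborel (\<lambda>x. cosh (h * t x) * p x)"
    using p_nonneg S
    by (intro Bochner_Integration.integrable_bound[OF integrable_mult_right[OF S, of "exp (b * h\<^sup>2 / 2)"]])
      (auto simp: cosh_field_def intro!: AE_I2 order_trans[OF _ abs_ge_self])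
  have "(\<integral>x. exp (- (b * h\<^sup>2 / 2)) * (cosh (h * t x) * p x) \<partial>lborel) \<le> (\<integral>x. ?S x \<partial>lborel)"
    by (intro integral_mono integrable_mult_right I S S_ge)
  then show "(\<integral>x. cosh (h * t x) * p x \<partial>lborel) \<le> exp (b * h\<^sup>2 / 2)"
    unfolding S1 by (simp add: exp_minus field_simps)
  have "(\<integral>x. ?S x \<partial>lborel) \<le> (\<integral>x. exp (- (a * h\<^sup>2 / 2)) * (cosh (h * t x) * p x) \<partial>lborel)"
    by (intro integral_mono integrable_mult_right I S S_le)
  then show "exp (a * h\<^sup>2 / 2) \<le> (\<integral>x. cosh (h * t x) * p x \<partial>lborel)"
    unfolding S1 by (simp add: exp_minus field_simps)
qed

text \<open>Dominated convergence along \<open>h = 1 / (n + 1)\<close>: the quotients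
  \<open>s n\<close> tend to \<open>(t x)\<^sup>2 * p x\<close>, which yields integrability of the
  limit as well as passage to the limit in both exponential bounds.\<close>

lemma
  fixes p U t :: "'a::euclidean_space \<Rightarrow> real"
  assumes "c > 0" and p: "\<And>x. p x = c * exp (- U x)"
    and int: "integrable lborel p" and int1: "(\<integral>x. p x \<partial>lborel) = 1"
    and t [measurable]: "t \<in> borel_measurable borel"
    and lower: "\<And>x h. U x + h * t x + a * h\<^sup>2 / 2 \<le> U (x + h *\<^sub>R v)"
    and upper: "\<And>x h. U (x + h *\<^sub>R v) \<le> U x + h * t x + b * h\<^sup>2 / 2"
  shows integrable_derivative_squared: "integrable lborel (\<lambda>x. (t x)\<^sup>2 * p x)"
    and integral_derivative_squared_ge: "a \<le> (\<integral>x. (t x)\<^sup>2 * p x \<partial>lborel)"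
    and integral_derivative_squared_le: "(\<integral>x. (t x)\<^sup>2 * p x \<partial>lborel) \<le> b"
proof -
  note cosh = integrable_cosh_derivative integral_cosh_derivative_ge integral_cosh_derivative_le
  note cosh = cosh[OF \<open>c > 0\<close> p int int1 t lower upper]
  define r where "r n = inverse (real (Suc n))" for n
  have r: "0 < r n" "r n \<le> 1" for n
    by (auto simp: r_def field_simps)
  have r0: "filterlim r (at_right 0) sequentially"
    unfolding r_def tendsto_at_right_sequentially filterlim_at
    using LIMSEQ_inverse_real_of_nat by auto
  define s where "s n x = 2 * (cosh (r n * t x) - 1) / (r n)\<^sup>2 * p x" for n x
  have p_nonneg: "p x \<ge> 0" for x
    using \<open>c > 0\<close> by (simp add: p)
  have [measurable]: "p \<in> borel_measurable borel"
    using int by simp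
  have [measurable]: "s n \<in> borel_measurable borel" for n
    unfolding s_def cosh_field_def by measurable
  have s_eq: "s n x = 2 / (r n)\<^sup>2 * (cosh (r n * t x) * p x - p x)" for n x
    by (simp add: s_def field_simps)
  have lim: "(\<lambda>n. s n x) \<longlonglongrightarrow> (t x)\<^sup>2 * p x" for x
    unfolding s_def
    by (intro tendsto_mult tendsto_const filterlim_compose[OF tendsto_cosh_quotient r0])
  \<comment> \<open>The dominating function is the quotient at \<open>h = 1\<close>; the factor
    \<open>1 *\<close> stays so that \<open>cosh(1)[of 1]\<close> applies verbatim.\<close>
  have bound: "norm (s n x) \<le> 2 * (cosh (1 * t x) * p x - p x)" for n x
  proof -
    have "2 * (cosh (r n * t x) - 1) / (r n)\<^sup>2 \<le> 2 * (cosh (t x) - 1)"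
      using cosh_scale_le[of "r n" "t x"] r[of n] by (simp add: field_simps)
    from mult_right_mono[OF this p_nonneg[of x]]
    have "s n x \<le> 2 * (cosh (1 * t x) * p x - p x)"
      by (simp add: s_def algebra_simps)
    moreover have "0 \<le> s n x"
      using p_nonneg[of x] cosh_real_ge_1[of "r n * t x"] by (simp add: s_def)
    ultimately show ?thesis
      by simp
  qed
  have w: "integrable lborel (\<lambda>x. 2 * (cosh (1 * t x) * p x - p x))"
    by (intro integrable_mult_right Bochner_Integration.integrable_diff cosh(1)[of 1] int)
  show "integrable lborel (\<lambda>x. (t x)\<^sup>2 * p x)"
    by (rule integrable_dominated_convergence[OF _ _ w, where s = s])
      (use lim bound in auto)
  have L: "(\<lambda>n. \<integral>x. s n x \<partial>lborel) \<longlonglongrightarrow> (\<integral>x. (t x)\<^sup>2 * p x \<partial>lborel)"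
    by (rule integral_dominated_convergence[OF _ _ w]) (use lim bound in auto)
  have int_s: "(\<integral>x. s n x \<partial>lborel) = 2 * ((\<integral>x. cosh (r n * t x) * p x \<partial>lborel) - 1) / (r n)\<^sup>2" for n
    unfolding s_eq using cosh(1)[of "r n"] int by (simp add: int1)
  have "2 * (exp (a * (r n)\<^sup>2 / 2) - 1) / (r n)\<^sup>2 \<le> (\<integral>x. s n x \<partial>lborel)" for n
    unfolding int_s using cosh(2)[of "r n"] by (intro divide_right_mono) auto
  then show "a \<le> (\<integral>x. (t x)\<^sup>2 * p x \<partial>lborel)"
    by (intro LIMSEQ_le[OF filterlim_compose[OF tendsto_exp_quotient r0] L]) auto
  have "(\<integral>x. s n x \<partial>lborel) \<le> 2 * (exp (b * (r n)\<^sup>2 / 2) - 1) / (r n)\<^sup>2" for n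
    unfolding int_s using cosh(3)[of "r n"] by (intro divide_right_mono) auto
  then show "(\<integral>x. (t x)\<^sup>2 * p x \<partial>lborel) \<le> b"
    by (intro LIMSEQ_le[OF L filterlim_compose[OF tendsto_exp_quotient r0]]) auto
qed

section \<open>Operator norms, outer products and integrals of matrices\<close>

lemma norm_matrix_vector_mult_le_op_norm:
  fixes A :: "real ^ 'n ^ 'm"
  shows "norm (A *v v) \<le> op_norm A * norm v"
  unfolding op_norm_def by (rule onorm) (rule matrix_vector_mul_bounded_linear)

text \<open>For symmetric \<open>A\<close>, the polarization identity bounds the bilinear form by the quadratic form.\<close>

lemma op_norm_symmetric_le:
  fixes A :: "real ^ 'n ^ 'n"
  assumes sym: "transpose A = A"
    and q: "\<And>v. \<bar>v \<bullet> (A *v v)\<bar> \<le> d * (norm v)\<^sup>2"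
  shows "op_norm A \<le> d"
  unfolding op_norm_def
proof (rule onorm_le)
  fix w
  show "norm (A *v w) \<le> d * norm w"
  proof (cases "A *v w = 0 \<or> w = 0")
    case True
    moreover have "0 \<le> d"
      \<comment> \<open>Testing the hypothesis on a unit vector forces \<open>d\<close> to be
        nonnegative.\<close>
      using q[of "axis undefined 1"] abs_ge_zero order_trans by (fastforce simp: norm_axis_1)
    ultimately show ?thesis
      by auto
  next
    case False
    \<comment> \<open>\<open>u\<close> points along \<open>A *v w\<close> but has the norm of
      \<open>w\<close>. Thus \<open>u \<bullet> (A *v w)\<close> is the product of the norms of
      \<open>w\<close> and \<open>A *v w\<close>, and the parallelogram law gives
      \<open>4 * d * (norm w)\<^sup>2\<close> below.\<close>
    define u where "u = (norm w / norm (A *v w)) *\<^sub>R (A *v w)"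
    have norm_u: "norm u = norm w"
      using False by (simp add: u_def)
    have swap: "w \<bullet> (A *v u) = u \<bullet> (A *v w)"
      by (metis dot_lmul_matrix inner_commute sym transpose_matrix_vector)
    have "4 * (u \<bullet> (A *v w)) = (u + w) \<bullet> (A *v (u + w)) - (u - w) \<bullet> (A *v (u - w))"
      using swap by (simp add: matrix_vector_right_distrib matrix_vector_mult_diff_distrib
          inner_add_left inner_add_right inner_diff_left inner_diff_right)
    also have "\<dots> \<le> d * (norm (u + w))\<^sup>2 + d * (norm (u - w))\<^sup>2"
      using q[of "u + w"] q[of "u - w"] by linarith
    also have "\<dots> = 4 * d * (norm w)\<^sup>2"
      using norm_u by (simp add: power2_norm_eq_inner inner_add_left inner_add_right inner_diff_left
          inner_diff_right norm_eq algebra_simps)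
    finally have "u \<bullet> (A *v w) \<le> d * norm w * norm w"
      by (simp add: power2_eq_square)
    also have "u \<bullet> (A *v w) = norm w * norm (A *v w)"
      using False by (simp add: u_def flip: power2_norm_eq_inner) (simp add: power2_eq_square)
    finally show ?thesis
      using False by (simp add: mult.commute[of "norm w"])
  qed
qed

text \<open>The norm here is the Frobenius norm, for which the outer product of \<open>y\<close>
  with itself has norm \<open>(norm y)\<^sup>2\<close>: row \<open>i\<close> is
  \<open>y $ i *\<^sub>R y\<close>. The sum of the squared coordinates is therefore an integrable
  bound.\<close>

lemma integrable_outer_product_self:
  fixes g :: "'a \<Rightarrow> real ^ 'n"
  assumes [measurable]: "g \<in> borel_measurable M"
    and g2: "\<And>v. integrable M (\<lambda>x. (g x \<bullet> v)\<^sup>2)"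
  shows "integrable M (\<lambda>x. outer_product (g x) (g x))"
proof (rule Bochner_Integration.integrable_bound)
  show "integrable M (\<lambda>x. \<Sum>i\<in>UNIV. (g x \<bullet> axis i 1)\<^sup>2)"
    by (intro Bochner_Integration.integrable_sum g2)
  have "continuous_on UNIV (\<lambda>y :: real ^ 'n. outer_product y y)"
    unfolding outer_product_def by (intro continuous_intros)
  then show "(\<lambda>x. outer_product (g x) (g x)) \<in> borel_measurable M"
    using borel_measurable_continuous_onI measurable_compose[OF assms(1)] by blast
  have "norm (outer_product y y) \<le> (\<Sum>i\<in>UNIV. (y $ i)\<^sup>2)" for y :: "real ^ 'n"
  proof -
    have "outer_product y y $ i = y $ i *\<^sub>R y" for i
      by (simp add: outer_product_def vec_eq_iff)
    then have "norm (outer_product y y) = norm y * norm y"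
      unfolding norm_vec_def[of "outer_product y y"]
      by (simp add: L2_set_left_distrib[symmetric] norm_vec_def[of y])
    then show ?thesis
      by (simp add: inner_vec_def power2_eq_square flip: dot_square_norm[unfolded power2_eq_square])
  qed
  then show "AE x in M. norm (outer_product (g x) (g x)) \<le> norm (\<Sum>i\<in>UNIV. (g x \<bullet> axis i 1)\<^sup>2)"
    by (auto simp: inner_axis intro!: AE_I2 order_trans[OF _ abs_ge_self])
qed

lemma inner_outer_product: "v \<bullet> (outer_product y y *v v) = (y \<bullet> v)\<^sup>2"
proof -
  have "outer_product y y *v v = (y \<bullet> v) *\<^sub>R y"
    by (simp add: outer_product_def inner_vec_def matrix_vector_mult_def vec_eq_iff sum_distrib_left
        mult_ac)
  then show ?thesis
    by (simp add: power2_eq_square inner_commute)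
qed

text \<open>Bounded linear maps commute with the Bochner integral; this reduces the quadratic form
  of the Fisher matrix to a scalar second moment.\<close>

lemma inner_integral_matrix:
  fixes F :: "'a \<Rightarrow> real ^ 'n ^ 'm"
  assumes "integrable M F"
  shows "v \<bullet> ((\<integral>x. F x \<partial>M) *v w) = (\<integral>x. v \<bullet> (F x *v w) \<partial>M)"
proof (rule integral_bounded_linear[OF _ assms, symmetric])
  show "bounded_linear (\<lambda>A :: real ^ 'n ^ 'm. v \<bullet> (A *v w))"
    by (intro linear_conv_bounded_linear[THEN iffD1] linearI)
      (simp_all add: matrix_vector_mult_add_rdistrib inner_add_right scaleR_matrix_vector_assoc[symmetric])
qed

lemma transpose_integral:
  fixes F :: "'a \<Rightarrow> real ^ 'n ^ 'm"
  assumes "integrable M F"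
  shows "transpose (\<integral>x. F x \<partial>M) = (\<integral>x. transpose (F x) \<partial>M)"
proof (rule integral_bounded_linear[OF _ assms, symmetric])
  show "bounded_linear (transpose :: real ^ 'n ^ 'm \<Rightarrow> _)"
    by (intro linear_conv_bounded_linear[THEN iffD1] linearI)
      (simp_all add: transpose_def vec_eq_iff)
qed

theorem proposition6:
  fixes P :: "(real ^ 'n) measure"
    and p U :: "real ^ 'n \<Rightarrow> real"
    and c :: real
    and L :: "real ^ 'n ^ 'n"
    and \<epsilon> :: real
  assumes "prob_space P"
    and "P = density lborel (\<lambda>x. ennreal (p x))"
    and "c > 0" and "\<And>x. p x = c * exp (- U x)"
    and "C2 U"
    and "invertible L"
    and "\<epsilon> > 0"
    and "\<And>x. op_norm (hessian U x - L ** transpose L)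
           \<le> least_eigenvalue (L ** transpose L) * \<epsilon>"
  shows "\<forall>x. op_norm (hessian U x - fisher_matrix P U)
           \<le> 2 * least_eigenvalue (L ** transpose L) * \<epsilon>"
proof -
  define B where "B = L ** transpose L"
  define d where "d = least_eigenvalue B * \<epsilon>"
  have hess: "op_norm (hessian U x - B) \<le> d" for x
    using assms(8) by (simp add: B_def d_def)
  \<comment> \<open>Cauchy-Schwarz turns the operator norm bound into the constants \<open>a\<close>
    and \<open>b\<close> for direction \<open>v\<close>: the value of the form of \<open>B\<close>
    at \<open>v\<close>, minus or plus \<open>d * (norm v)\<^sup>2\<close>.\<close>
  have "\<bar>v \<bullet> (hessian U x *v v) - v \<bullet> (B *v v)\<bar> \<le> d * (norm v)\<^sup>2" for x v
  proof -
    have "\<bar>v \<bullet> ((hessian U x - B) *v v)\<bar> \<le> norm v * norm ((hessian U x - B) *v v)"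
      by (rule Cauchy_Schwarz_ineq2)
    also have "\<dots> \<le> norm v * (d * norm v)"
      using hess[of x]
      by (intro mult_left_mono order_trans[OF norm_matrix_vector_mult_le_op_norm] mult_right_mono) auto
    finally show ?thesis
      by (simp add: matrix_vector_mult_diff_rdistrib inner_diff_right power2_eq_square algebra_simps)
  qed
  then have "v \<bullet> (B *v v) - d * (norm v)\<^sup>2 \<le> v \<bullet> (hessian U x *v v)"
    "v \<bullet> (hessian U x *v v) \<le> v \<bullet> (B *v v) + d * (norm v)\<^sup>2" for x v
    by (smt (verit))+
  note taylor = C2_Taylor_bounds[OF \<open>C2 U\<close> this]
  have p_eq: "p = (\<lambda>x. c * exp (- U x))"
    using assms(4) by auto
  have "continuous_on UNIV U" "continuous_on UNIV (gradient U)"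
    using \<open>C2 U\<close> by (auto simp: C2_def intro!: differentiable_imp_continuous_on
        simp: differentiable_on_def)
  then have [measurable]: "U \<in> borel_measurable borel" "gradient U \<in> borel_measurable borel"
    by (auto intro: borel_measurable_continuous_onI)
  have p_meas [measurable]: "p \<in> borel_measurable borel"
    unfolding p_eq by measurable
  have p_nonneg: "p x \<ge> 0" for x
    using assms(3,4) by simp
  interpret P: prob_space P by fact
  \<comment> \<open>Read through the density, total mass 1 of \<open>P\<close> says that
    \<open>p\<close> is integrable with integral 1.\<close>
  have "integrable P (\<lambda>_. 1 :: real)"
    by simp
  then have int: "integrable lborel p"
    unfolding assms(2) by (simp add: integrable_density p_nonneg)
  have "(\<integral>x. p x *\<^sub>R (1 :: real) \<partial>lborel) = (\<integral>x. 1 \<partial>P)"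
    unfolding assms(2) by (subst integral_density) (auto simp: p_nonneg)
  then have int1: "(\<integral>x. p x \<partial>lborel) = 1"
    using P.prob_space by simp
  note moment = integrable_derivative_squared integral_derivative_squared_ge
    integral_derivative_squared_le
  note moment = moment[OF \<open>c > 0\<close> assms(4) int int1 _ taylor]
  have g2: "integrable P (\<lambda>x. (gradient U x \<bullet> v)\<^sup>2)" for v
    unfolding assms(2) using moment(1)[of v] by (simp add: integrable_density p_nonneg mult.commute)
  have P_sets [measurable_cong]: "sets P = sets borel"
    unfolding assms(2) by simp
  have outer: "integrable P (\<lambda>x. outer_product (gradient U x) (gradient U x))"
    by (intro integrable_outer_product_self g2) measurable
  have quad: "v \<bullet> (fisher_matrix P U *v v) = (\<integral>x. (gradient U x \<bullet> v)\<^sup>2 * p x \<partial>lborel)" for v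
    unfolding fisher_matrix_def inner_integral_matrix[OF outer] inner_outer_product
    unfolding assms(2) by (simp add: integral_density p_nonneg mult.commute)
  \<comment> \<open>The moment bounds place the form of the Fisher matrix in the same interval
    around that of \<open>B\<close> as the Hessian's. Symmetry then upgrades this to an operator
    norm bound.\<close>
  have "\<bar>v \<bullet> ((fisher_matrix P U - B) *v v)\<bar> \<le> d * (norm v)\<^sup>2" for v
    using moment(2,3)[of v]
    by (simp add: matrix_vector_mult_diff_rdistrib inner_diff_right quad abs_le_iff)
  moreover have "transpose (fisher_matrix P U - B) = fisher_matrix P U - B"
  proof -
    have "transpose (fisher_matrix P U) = fisher_matrix P U"
      unfolding fisher_matrix_def transpose_integral[OF outer]
      by (simp add: outer_product_def transpose_def mult.commute)
    moreover have "transpose B = B"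
      by (simp add: B_def matrix_transpose_mul)
    ultimately show ?thesis
      by (simp add: transpose_def vec_eq_iff)
  qed
  ultimately have fisher: "op_norm (fisher_matrix P U - B) \<le> d"
    by (intro op_norm_symmetric_le)
  \<comment> \<open>Both matrices lie within \<open>d\<close> of \<open>B\<close>; the triangle
    inequality through \<open>B\<close> produces the factor 2.\<close>
  have "op_norm (hessian U x - fisher_matrix P U) \<le> 2 * d" for x
    unfolding op_norm_def
  proof (rule onorm_le)
    fix v
    have "(hessian U x - fisher_matrix P U) *v v
        = (hessian U x - B) *v v - (fisher_matrix P U - B) *v v"
      by (simp add: matrix_vector_mult_diff_rdistrib)
    also have "norm \<dots> \<le> norm ((hessian U x - B) *v v) + norm ((fisher_matrix P U - B) *v v)"
      by (rule norm_triangle_ineq4)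
    also have "\<dots> \<le> d * norm v + d * norm v"
      using hess[of x] fisher
      by (intro add_mono order_trans[OF norm_matrix_vector_mult_le_op_norm] mult_right_mono) auto
    finally show "norm ((hessian U x - fisher_matrix P U) *v v) \<le> 2 * d * norm v"
      by simp
  qed
  then show ?thesis
    by (simp add: d_def B_def mult.assoc)
qed

end
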